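(* Let $p$ be a prime number and $P$ a finite free $\mathbb Z/p$-poset. Then for every integer $r$ with $2\leq r\leq p$, \[ \left\lceil\frac{\operatorname{ind}\|\Delta (P)\|+1}{r-1}\right\rceil+ \left\lceil\frac{p}{r-1}\right\rceil-1\leq\chi\left(\mathcal{C}_P^{(r)}\right). \]
   Context: A $G$-poset is a poset $(P,\preceq)$ with a $G$-action such that $a\preceq b$ implies $g a\preceq g b$; it is free if $g p=p$ implies $g=e$. The order complex $\Delta(P)$ is the simplicial complex of all nonempty chains of $P$, with the induced action; $\|\cdot\|$ is geometric realization. For $r\ge2$, the compatibility $r$-uniform hypergraph $\mathcal C_P^{(r)}$ has vertex set $P$, and a set $\{p_1,\dots,p_r\}$ of $r$ distinct elements is an edge iff for all distinct $p_i,p_j$ in it there is $g\in G\setminus\{e\}$ with $p_i$ and $g\cdot p_j$ comparable. A proper $m$-coloring of a hypergraph is a map $V\to\{1,\dots,m\}$ with no monochromatic edge; $\chi$ is the least such $m$. $E_kG=G*\cdots*G$ ($k+1$ factors, join action $g\cdot((1-t)a\oplus tb)=(1-t)(ga)\oplus t(gb)$), and $\operatorname{ind} X$ is the minimal $k$ with a $G$-equivariant map $X\to E_kG$. *)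

theory Defs
  imports
    "HOL-Analysis.Analysis"
    "HOL-Algebra.Elementary_Groups"
    "HOL-Algebra.Group_Action"
    "HOL-Computational_Algebra.Primes"
begin

section \<open>Posets with a group action\<close>

definition G_poset ::
  "('g, 'm) monoid_scheme \<Rightarrow> 'a set \<Rightarrow> 'a rel \<Rightarrow> ('g \<Rightarrow> 'a \<Rightarrow> 'a) \<Rightarrow> bool"
  where "G_poset G P R \<phi> \<longleftrightarrow>
    partial_order_on P R \<and> group_action G P \<phi> \<and>
    (\<forall>g\<in>carrier G. \<forall>a b. (a, b) \<in> R \<longrightarrow> (\<phi> g a, \<phi> g b) \<in> R)"

definition free_G_poset ::
  "('g, 'm) monoid_scheme \<Rightarrow> 'a set \<Rightarrow> 'a rel \<Rightarrow> ('g \<Rightarrow> 'a \<Rightarrow> 'a) \<Rightarrow> bool"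
  where "free_G_poset G P R \<phi> \<longleftrightarrow>
    G_poset G P R \<phi> \<and>
    (\<forall>g\<in>carrier G. \<forall>x\<in>P. \<phi> g x = x \<longrightarrow> g = \<one>\<^bsub>G\<^esub>)"

definition comparable :: "'a rel \<Rightarrow> 'a \<Rightarrow> 'a \<Rightarrow> bool"
  where "comparable R x y \<longleftrightarrow> (x, y) \<in> R \<or> (y, x) \<in> R"


section \<open>Hypergraph colorings and the compatibility hypergraph\<close>

text \<open>A hypergraph is given by its vertex set and its set of edges.\<close>

definition proper_coloring :: "'a set \<Rightarrow> 'a set set \<Rightarrow> nat \<Rightarrow> ('a \<Rightarrow> nat) \<Rightarrow> bool"
  where "proper_coloring V E m c \<longleftrightarrow>
    c \<in> V \<rightarrow> {1..m} \<and> (\<forall>e\<in>E. \<not> (\<exists>i. \<forall>v\<in>e. c v = i))"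

definition chromatic_number :: "'a set \<Rightarrow> 'a set set \<Rightarrow> nat"
  where "chromatic_number V E = (LEAST m. \<exists>c. proper_coloring V E m c)"

definition compatibility_edges ::
  "('g, 'm) monoid_scheme \<Rightarrow> 'a set \<Rightarrow> 'a rel \<Rightarrow> ('g \<Rightarrow> 'a \<Rightarrow> 'a) \<Rightarrow> nat \<Rightarrow> 'a set set"
  where "compatibility_edges G P R \<phi> r =
    {e. e \<subseteq> P \<and> finite e \<and> card e = r \<and>
        (\<forall>x\<in>e. \<forall>y\<in>e. x \<noteq> y \<longrightarrow>
          (\<exists>g\<in>carrier G - {\<one>\<^bsub>G\<^esub>}. comparable R x (\<phi> g y)))}"


section \<open>Order complex and geometric realization\<close>

text \<open>A simplicial complex is given by its set of (finite, nonempty) simplices.\<close>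

definition order_complex :: "'a set \<Rightarrow> 'a rel \<Rightarrow> 'a set set"
  where "order_complex P R =
    {C. C \<subseteq> P \<and> C \<noteq> {} \<and> finite C \<and> (\<forall>x\<in>C. \<forall>y\<in>C. comparable R x y)}"

text \<open>Points of the realization are given by their barycentric coordinates, extended by zero
  to all of the type. The topology is the weak one: each closed simplex carries the
  Euclidean topology, and a set is open iff its trace on every closed simplex is open.\<close>

definition realization_points :: "'v set set \<Rightarrow> ('v \<Rightarrow> real) set"
  where "realization_points K =
    {x. (\<forall>v. 0 \<le> x v) \<and> {v. x v \<noteq> 0} \<in> K \<and> (\<Sum>v | x v \<noteq> 0. x v) = 1}"

definition closed_simplex :: "'v set set \<Rightarrow> 'v set \<Rightarrow> ('v \<Rightarrow> real) set"
  where "closed_simplex K \<sigma> = {x \<in> realization_points K. {v. x v \<noteq> 0} \<subseteq> \<sigma>}"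

definition geometric_realization :: "'v set set \<Rightarrow> ('v \<Rightarrow> real) topology"
  where "geometric_realization K = topology (\<lambda>U. U \<subseteq> realization_points K \<and>
    (\<forall>\<sigma>\<in>K. openin (top_of_set (closed_simplex K \<sigma>)) (U \<inter> closed_simplex K \<sigma>)))"

lemma openin_geometric_realization:
  "openin (geometric_realization K) U \<longleftrightarrow> U \<subseteq> realization_points K \<and>
    (\<forall>\<sigma>\<in>K. openin (top_of_set (closed_simplex K \<sigma>)) (U \<inter> closed_simplex K \<sigma>))"
proof -
  let ?O = "\<lambda>U \<sigma>. openin (top_of_set (closed_simplex K \<sigma>)) (U \<inter> closed_simplex K \<sigma>)"
  have "?O (S \<inter> T) \<sigma>" if "?O S \<sigma>" "?O T \<sigma>" for S T \<sigma>
    using openin_Int[OF that] by (simp add: Int_ac)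
  moreover have "?O (\<Union>\<K>) \<sigma>" if "\<And>S. S \<in> \<K> \<Longrightarrow> ?O S \<sigma>" for \<K> \<sigma>
    unfolding Int_Union2 using that by (intro openin_Union) auto
  ultimately have "istopology (\<lambda>U. U \<subseteq> realization_points K \<and> (\<forall>\<sigma>\<in>K. ?O U \<sigma>))"
    unfolding istopology_def by (simp add: le_infI1 Sup_le_iff)
  then show ?thesis
    unfolding geometric_realization_def by (simp add: topology_inverse')
qed

text \<open>The affine extension of a vertex map; applied to the maps \<^term>\<open>\<phi> g\<close> it gives the
  induced action on the realization of the order complex.\<close>

definition realization_map :: "('v \<Rightarrow> 'w) \<Rightarrow> ('v \<Rightarrow> real) \<Rightarrow> ('w \<Rightarrow> real)"
  where "realization_map f x = (\<lambda>w. \<Sum>v | x v \<noteq> 0 \<and> f v = w. x v)"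


section \<open>Joins, the spaces $E_kG$, and the index\<close>

definition quotient_topology :: "'a topology \<Rightarrow> ('a \<Rightarrow> 'b) \<Rightarrow> 'b topology"
  where "quotient_topology X q = topology (\<lambda>U. U \<subseteq> q ` topspace X \<and>
    openin X {x \<in> topspace X. q x \<in> U})"

lemma openin_quotient_topology:
  "openin (quotient_topology X q) U \<longleftrightarrow>
    U \<subseteq> q ` topspace X \<and> openin X {x \<in> topspace X. q x \<in> U}"
proof -
  let ?V = "\<lambda>U. {x \<in> topspace X. q x \<in> U}"
  have "?V (S \<inter> T) = ?V S \<inter> ?V T" "?V (\<Union>\<K>) = (\<Union>S\<in>\<K>. ?V S)" for S T \<K>
    by auto
  then have "istopology (\<lambda>U. U \<subseteq> q ` topspace X \<and> openin X (?V U))"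
    unfolding istopology_def by (auto simp only: Sup_le_iff intro!: openin_Int openin_Union le_infI1)
  then show ?thesis
    unfolding quotient_topology_def by (simp add: topology_inverse')
qed

text \<open>The spaces $E_kG$ for all $k$ live in one type of iterated formal combinations
  $(1-t)a \oplus tb$. The two end constructors stand for $t = 0$ and $t = 1$, where the
  combination does not depend on $b$ and $a$, respectively; \<open>Mix\<close> is used only for
  $0 < t < 1$.\<close>

datatype 'g join_point =
    Pt 'g
  | Left_End "'g join_point"
  | Right_End "'g join_point"
  | Mix real "'g join_point" "'g join_point"

definition join_combination :: "real \<Rightarrow> 'g join_point \<Rightarrow> 'g join_point \<Rightarrow> 'g join_point"
  where "join_combination t a b =
    (if t = 0 then Left_End a else if t = 1 then Right_End b else Mix t a b)"

text \<open>The join of nonempty spaces, as the quotient of $X \times Y \times [0,1]$.\<close>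

definition join_topology ::
  "'g join_point topology \<Rightarrow> 'g join_point topology \<Rightarrow> 'g join_point topology"
  where "join_topology X Y =
    quotient_topology (prod_topology X (prod_topology Y (top_of_set {0..1})))
      (\<lambda>(a, b, t). join_combination t a b)"

definition discrete_group_space :: "('g, 'm) monoid_scheme \<Rightarrow> 'g join_point topology"
  where "discrete_group_space G = discrete_topology (Pt ` carrier G)"

primrec E_space :: "('g, 'm) monoid_scheme \<Rightarrow> nat \<Rightarrow> 'g join_point topology"
  where
    "E_space G 0 = discrete_group_space G"
  | "E_space G (Suc k) = join_topology (E_space G k) (discrete_group_space G)"

definition join_action ::
  "('g, 'm) monoid_scheme \<Rightarrow> 'g \<Rightarrow> 'g join_point \<Rightarrow> 'g join_point"
  where "join_action G g = map_join_point (\<lambda>h. g \<otimes>\<^bsub>G\<^esub> h)"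

lemma join_action_Pt: "join_action G g (Pt h) = Pt (g \<otimes>\<^bsub>G\<^esub> h)"
  by (simp add: join_action_def)

lemma join_action_combination:
  "join_action G g (join_combination t a b) =
    join_combination t (join_action G g a) (join_action G g b)"
  by (simp add: join_action_def join_combination_def)

definition equivariant_map ::
  "('g, 'm) monoid_scheme \<Rightarrow> 'x topology \<Rightarrow> ('g \<Rightarrow> 'x \<Rightarrow> 'x) \<Rightarrow>
    'y topology \<Rightarrow> ('g \<Rightarrow> 'y \<Rightarrow> 'y) \<Rightarrow> ('x \<Rightarrow> 'y) \<Rightarrow> bool"
  where "equivariant_map G X \<alpha> Y \<beta> f \<longleftrightarrow>
    continuous_map X Y f \<and>
    (\<forall>g\<in>carrier G. \<forall>x\<in>topspace X. f (\<alpha> g x) = \<beta> g (f x))"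

text \<open>Meaningful only if some equivariant map to some $E_kG$ exists, as is the case for the
  realization of the order complex of a finite free $G$-poset. The index of the empty space,
  conventionally $-1$, is not covered.\<close>

definition G_index :: "('g, 'm) monoid_scheme \<Rightarrow> 'x topology \<Rightarrow> ('g \<Rightarrow> 'x \<Rightarrow> 'x) \<Rightarrow> nat"
  where "G_index G X \<alpha> =
    (LEAST k. \<exists>f. equivariant_map G X \<alpha> (E_space G k) (join_action G) f)"

end

theory Submission
  imports Defs "HOL-Algebra.Multiplicative_Group" "HOL-Number_Theory.Cong"
begin

text \<open>Let \<open>c\<close> be a proper \<open>m\<close>-coloring. A point \<open>x\<close> of the realization, supported on a chain,
  determines the pattern of all pairs \<open>(g, i)\<close> such that some \<open>g y\<close> in the chain has
  \<open>c y = i\<close>. Every \<open>g\<close> occurs in it, and each color occurs at most \<open>r - 1\<close> times, because \<open>r\<close>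
  occurrences would give a monochromatic edge. Patterns have between \<open>p\<close> and \<open>m (r - 1)\<close>
  elements, so chains of patterns have dimension at most \<open>m (r - 1) - p\<close>, and $\mathbb{Z}/p$ acts freely
  on them. A continuous assignment of weights on chains of patterns, together with an equivariant
  labelling of patterns by group elements, yields an equivariant map to $E_k(\mathbb{Z}/p)$ with
  \<open>k = m (r - 1) - p\<close>. Hence the index plus \<open>p\<close> is at most \<open>m (r - 1)\<close>, which implies the claimed
  bound.\<close>

section \<open>Maps into iterated joins\<close>


lemma topspace_quotient_topology: "topspace (quotient_topology X q) = q ` topspace X"
proof -
  have "{x \<in> topspace X. q x \<in> q ` topspace X} = topspace X"
    by auto
  then have "openin (quotient_topology X q) (q ` topspace X)"
    by (simp add: openin_quotient_topology)
  then show ?thesis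
    unfolding topspace_def[of "quotient_topology X q"]
    by (auto simp: openin_quotient_topology)
qed

lemma continuous_map_quotient_topology: "continuous_map X (quotient_topology X q) q"
  by (auto simp: continuous_map_def topspace_quotient_topology openin_quotient_topology)

lemma compact_space_quotient_topology:
  assumes "compact_space X"
  shows "compact_space (quotient_topology X q)"
  using image_compactin[OF _ continuous_map_quotient_topology, of X "topspace X" q] assms
  by (simp add: compact_space_def topspace_quotient_topology)

text \<open>Each join is a continuous image of a product of compact spaces, starting from a finite
  discrete one. Compactness makes the projection along \<open>E_space G k\<close> closed, on which
  continuity at parameter 1 rests.\<close>

lemma compact_E_space:
  assumes "finite (carrier G)"
  shows "compact_space (E_space G k)"
proof (induction k)
  case 0
  show ?case
    using assms by (simp add: discrete_group_space_def compact_space_discrete_topology)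
next
  case (Suc k)
  moreover have "compact_space (discrete_group_space G)"
    using assms by (simp add: discrete_group_space_def compact_space_discrete_topology)
  moreover have "compact_space (top_of_set {0..1::real})"
    by (simp add: compact_space_subtopology)
  ultimately show ?case
    by (simp add: join_topology_def compact_space_quotient_topology compact_space_prod_topology)
qed

lemma E_space_nonempty:
  assumes "carrier G \<noteq> {}"
  shows "topspace (E_space G k) \<noteq> {}"
proof (induction k)
  case 0
  show ?case
    using assms by (simp add: discrete_group_space_def)
next
  case (Suc k)
  then show ?case
    using assms by (simp add: join_topology_def topspace_quotient_topology discrete_group_space_def)
qed

section \<open>Weights on levels as coordinates of a point of the join\<close>

definition level_weight ::
  "('g, 'm) monoid_scheme \<Rightarrow> (nat \<Rightarrow> 'g \<Rightarrow> 'x \<Rightarrow> real) \<Rightarrow> nat \<Rightarrow> 'x \<Rightarrow> real"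
  where "level_weight G u j x = (\<Sum>g\<in>carrier G. u j g x)"

definition level_element ::
  "('g, 'm) monoid_scheme \<Rightarrow> (nat \<Rightarrow> 'g \<Rightarrow> 'x \<Rightarrow> real) \<Rightarrow> nat \<Rightarrow> 'x \<Rightarrow> 'g"
  where "level_element G u j x =
    (SOME g. g \<in> carrier G \<and> (\<forall>h\<in>carrier G. h \<noteq> g \<longrightarrow> u j h x = 0))"

text \<open>With the share of level \<open>k\<close> among the levels up to \<open>k\<close> as
  parameter, the nested binary joins reproduce the normalized weights.\<close>

definition join_parameter ::
  "('g, 'm) monoid_scheme \<Rightarrow> (nat \<Rightarrow> 'g \<Rightarrow> 'x \<Rightarrow> real) \<Rightarrow> nat \<Rightarrow> 'x \<Rightarrow> real"
  where "join_parameter G u k x = level_weight G u k x / (\<Sum>j\<le>k. level_weight G u j x)"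

primrec join_map ::
  "('g, 'm) monoid_scheme \<Rightarrow> (nat \<Rightarrow> 'g \<Rightarrow> 'x \<Rightarrow> real) \<Rightarrow> nat \<Rightarrow> 'x \<Rightarrow> 'g join_point"
  where
    "join_map G u 0 x = Pt (level_element G u 0 x)"
  | "join_map G u (Suc k) x = join_combination (join_parameter G u (Suc k) x)
      (join_map G u k x) (Pt (level_element G u (Suc k) x))"

text \<open>\<open>u j g x\<close> is the barycentric coordinate, up to normalization, of the vertex \<open>g\<close> in the
  \<open>j\<close>-th join factor. Where all \<open>u j g x\<close> of a level vanish, \<^const>\<open>level_element\<close> is arbitrary,
  but then the join combination ignores it; likewise for the left factor at parameter 1.\<close>

locale join_coordinates =
  fixes G :: "('g, 'm) monoid_scheme" and u :: "nat \<Rightarrow> 'g \<Rightarrow> 'x \<Rightarrow> real"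
  assumes finite_carrier: "finite (carrier G)"
    and carrier_nonempty: "carrier G \<noteq> {}"
    and nonneg: "\<And>j g x. 0 \<le> u j g x"
    and unique: "\<And>j g h x. 0 < u j g x \<Longrightarrow> 0 < u j h x \<Longrightarrow> g = h"
begin

lemma level_weight_nonneg: "0 \<le> level_weight G u j x"
  unfolding level_weight_def by (intro sum_nonneg nonneg)

lemma level_weight_pos_iff: "0 < level_weight G u j x \<longleftrightarrow> (\<exists>g\<in>carrier G. 0 < u j g x)"
proof -
  have "level_weight G u j x = 0 \<longleftrightarrow> (\<forall>g\<in>carrier G. u j g x = 0)"
    unfolding level_weight_def using finite_carrier nonneg by (intro sum_nonneg_eq_0_iff) auto
  then show ?thesis
    using level_weight_nonneg[of j x] nonneg by (auto simp: less_le)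
qed

lemma total_pos_iff:
  "0 < (\<Sum>j\<le>k. level_weight G u j x) \<longleftrightarrow> (\<exists>j\<le>k. \<exists>g\<in>carrier G. 0 < u j g x)"
proof -
  have "0 < (\<Sum>j\<le>k. level_weight G u j x) \<longleftrightarrow> (\<exists>j\<le>k. 0 < level_weight G u j x)"
    using sum_nonneg_eq_0_iff[of "{..k}" "\<lambda>j. level_weight G u j x"]
      sum_nonneg[of "{..k}" "\<lambda>j. level_weight G u j x"] level_weight_nonneg
    by (auto simp: less_le)
  then show ?thesis
    by (simp add: level_weight_pos_iff)
qed

text \<open>If some weight of the level is positive on the carrier, \<open>unique\<close> forces the
  others to vanish; if none is, every element qualifies. So the choice always has a witness.\<close>

lemma level_element_carrier: "level_element G u j x \<in> carrier G"
  and level_element_zero: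
    "h \<in> carrier G \<Longrightarrow> h \<noteq> level_element G u j x \<Longrightarrow> u j h x = 0"
proof -
  have "\<exists>g. g \<in> carrier G \<and> (\<forall>h\<in>carrier G. h \<noteq> g \<longrightarrow> u j h x = 0)"
    using carrier_nonempty nonneg unique by (metis ex_in_conv less_eq_real_def)
  from someI_ex[OF this] show "level_element G u j x \<in> carrier G"
    "h \<in> carrier G \<Longrightarrow> h \<noteq> level_element G u j x \<Longrightarrow> u j h x = 0"
    unfolding level_element_def by blast+
qed

lemma level_element_eq: "g \<in> carrier G \<Longrightarrow> 0 < u j g x \<Longrightarrow> level_element G u j x = g"
  using level_element_zero[of g j x] by fastforce

lemma level_element_pos:
  "0 < level_weight G u j x \<Longrightarrow> 0 < u j (level_element G u j x) x"
  using level_element_eq by (auto simp: level_weight_pos_iff)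

text \<open>A vanishing total gives parameter 0, since division by zero yields 0; hence the bounds
  hold at every point.\<close>

lemma join_parameter_bounds: "0 \<le> join_parameter G u k x" "join_parameter G u k x \<le> 1"
proof -
  have "0 \<le> (\<Sum>j\<in>{..k} - {k}. level_weight G u j x)"
    by (intro sum_nonneg level_weight_nonneg)
  then have "level_weight G u k x \<le> (\<Sum>j\<le>k. level_weight G u j x)"
    by (simp add: sum.remove[of "{..k}" k])
  then show "0 \<le> join_parameter G u k x" "join_parameter G u k x \<le> 1"
    using level_weight_nonneg[of k x] unfolding join_parameter_def
    by (auto simp: divide_le_eq_1)
qed

text \<open>The denominator exceeds the numerator by the total weight of the levels up to
  \<open>k\<close>. This locates the points where the left factor matters and an induction on
  \<open>k\<close> can proceed.\<close>

lemma join_parameter_less_1_iff: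
  assumes "\<exists>j\<le>Suc k. \<exists>g\<in>carrier G. 0 < u j g x"
  shows "join_parameter G u (Suc k) x < 1 \<longleftrightarrow> (\<exists>j\<le>k. \<exists>g\<in>carrier G. 0 < u j g x)"
proof -
  have "0 < (\<Sum>j\<le>Suc k. level_weight G u j x)"
    using assms total_pos_iff by blast
  then show ?thesis
    unfolding total_pos_iff[symmetric] join_parameter_def by (simp add: divide_less_eq)
qed

lemma join_parameter_pos_iff:
  assumes "\<exists>j\<le>k. \<exists>g\<in>carrier G. 0 < u j g x"
  shows "0 < join_parameter G u k x \<longleftrightarrow> (\<exists>g\<in>carrier G. 0 < u k g x)"
proof -
  have "0 < (\<Sum>j\<le>k. level_weight G u j x)"
    using assms total_pos_iff by blast
  then show ?thesis
    unfolding level_weight_pos_iff[symmetric] join_parameter_def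
    by (simp add: zero_less_divide_iff)
qed

text \<open>The space varies in the induction because the lower levels have positive weight only on
  an open subspace. Off that subspace the parameter is 1. Open neighbourhoods inside preimages are
  found separately for parameter 0, strictly between, and 1.\<close>

lemma continuous_join_map:
  assumes "\<And>j g. j \<le> k \<Longrightarrow> g \<in> carrier G \<Longrightarrow> continuous_map X euclideanreal (u j g)"
    and "\<And>x. x \<in> topspace X \<Longrightarrow> \<exists>j\<le>k. \<exists>g\<in>carrier G. 0 < u j g x"
  shows "continuous_map X (E_space G k) (join_map G u k)"
  using assms
proof (induction k arbitrary: X)
  case 0
  have "openin X {x \<in> topspace X. Pt (level_element G u 0 x) \<in> U}" for U
  proof -
    \<comment> \<open>A positive weight determines the element, so the map is locally
      constant.\<close>
    have "{x \<in> topspace X. Pt (level_element G u 0 x) \<in> U} =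
      (\<Union>g\<in>{g\<in>carrier G. Pt g \<in> U}. {x \<in> topspace X. u 0 g x \<in> {0<..}})"
      using 0(2) level_element_eq level_element_carrier by fastforce
    moreover have "openin X {x \<in> topspace X. u 0 g x \<in> {0<..}}" if "g \<in> carrier G" for g
      using that by (intro openin_continuous_map_preimage[OF 0(1)]) auto
    ultimately show ?thesis
      by auto
  qed
  then show ?case
    using level_element_carrier by (auto simp: continuous_map_def discrete_group_space_def)
next
  case (Suc k)
  define t where "t = join_parameter G u (Suc k)"
  define D where "D = prod_topology (E_space G k)
    (prod_topology (discrete_group_space G) (top_of_set {0..1::real}))"
  define q :: "'g join_point \<times> 'g join_point \<times> real \<Rightarrow> 'g join_point"
    where "q = (\<lambda>(a, b, s). join_combination s a b)"
  have E_Suc: "E_space G (Suc k) = quotient_topology D q"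
    by (simp add: join_topology_def D_def q_def)
  have t_bounds: "0 \<le> t x" "t x \<le> 1" for x
    using join_parameter_bounds by (simp_all add: t_def)
  have weight_cont: "continuous_map X euclideanreal (level_weight G u j)" if "j \<le> Suc k" for j
    unfolding level_weight_def using that Suc.prems(1) finite_carrier
    by (intro continuous_map_sum) auto
  have "continuous_map X euclideanreal t"
    unfolding t_def join_parameter_def
  proof (intro continuous_map_real_divide continuous_map_sum weight_cont)
    fix x assume "x \<in> topspace X"
    then show "(\<Sum>j\<le>Suc k. level_weight G u j x) \<noteq> 0"
      using Suc.prems(2) total_pos_iff[of x "Suc k"] by (metis less_irrefl)
  qed auto
  then have t_cont: "continuous_map X (top_of_set {0..1}) t"
    using t_bounds by (auto simp: continuous_map_in_subtopology)
  \<comment> \<open>The region where the left factor is visible.\<close>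
  define X0 where "X0 = {x \<in> topspace X. t x \<in> {..<1}}"
  have X0: "openin X X0"
    unfolding X0_def
    by (intro openin_continuous_map_preimage[OF \<open>continuous_map X euclideanreal t\<close>]) auto
  have X0_iff: "x \<in> X0 \<longleftrightarrow> (\<exists>j\<le>k. \<exists>g\<in>carrier G. 0 < u j g x)" if "x \<in> topspace X" for x
    using that Suc.prems(2)[OF that] by (auto simp: X0_def t_def join_parameter_less_1_iff)
  have IH: "continuous_map (subtopology X X0) (E_space G k) (join_map G u k)"
  proof (rule Suc.IH)
    show "continuous_map (subtopology X X0) euclideanreal (u j g)"
      if "j \<le> k" "g \<in> carrier G" for j g
      using that Suc.prems(1) by (auto intro!: continuous_map_from_subtopology)
  qed (use X0_iff in auto)
  have F: "join_map G u (Suc k) x = q (join_map G u k x, Pt (level_element G u (Suc k) x), t x)" for x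
    by (simp add: q_def t_def)
  have Pt: "Pt g \<in> topspace (discrete_group_space G)" if "g \<in> carrier G" for g
    using that by (simp add: discrete_group_space_def)
  \<comment> \<open>A stand-in for the left point at parameter 1, where the combination ignores
    it.\<close>
  obtain a0 where a0: "a0 \<in> topspace (E_space G k)"
    using E_space_nonempty[OF carrier_nonempty] by blast
  have join_map_mem: "join_map G u k x \<in> topspace (E_space G k)" if "x \<in> X0" for x
    using continuous_map_image_subset_topspace[OF IH] that openin_subset[OF X0] by auto
  have level_eq: "level_element G u (Suc k) x = g" if "g \<in> carrier G" "0 < u (Suc k) g x" for x g
    using level_element_eq that by blast
  have upos: "openin X {y \<in> topspace X. u (Suc k) g y \<in> {0<..}}" if "g \<in> carrier G" for g
    using that by (intro openin_continuous_map_preimage[OF Suc.prems(1)]) auto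
  have t_pos: "0 < u (Suc k) (level_element G u (Suc k) x) x" if "x \<in> topspace X" "0 < t x" for x
    using that Suc.prems(2)[OF that(1)] level_element_pos
    by (simp add: t_def join_parameter_pos_iff level_weight_pos_iff)
  have F_mem: "join_map G u (Suc k) x \<in> q ` topspace D" if "x \<in> topspace X" for x
  proof (cases "t x < 1")
    case True
    with that have "x \<in> X0" by (simp add: X0_def)
    then show ?thesis
      unfolding F using join_map_mem Pt level_element_carrier t_bounds by (auto simp: D_def)
  next
    case False
    then have "t x = 1" using t_bounds[of x] by simp
    then have "join_map G u (Suc k) x = q (a0, Pt (level_element G u (Suc k) x), 1)"
      unfolding F by (simp add: q_def join_combination_def)
    then show ?thesis
      using a0 Pt level_element_carrier by (auto simp: D_def)
  qed
  have "openin X {x \<in> topspace X. join_map G u (Suc k) x \<in> W}"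
    if W: "openin (quotient_topology D q) W" for W
  proof -
    define V where "V = {z \<in> topspace D. q z \<in> W}"
    have V: "openin D V"
      using W by (simp add: V_def openin_quotient_topology)
    \<comment> \<open>The right coordinate is frozen at \<open>g\<close>, since
      \<open>level_element\<close> need not vary continuously where its level vanishes.\<close>
    define T where "T g = {y \<in> topspace (subtopology X X0). (join_map G u k y, Pt g, t y) \<in> V}" for g
    have T: "openin X (T g)" if "g \<in> carrier G" for g
    proof -
      have "continuous_map (subtopology X X0) D (\<lambda>y. (join_map G u k y, Pt g, t y))"
        unfolding D_def using IH t_cont Pt[OF that]
        by (intro continuous_map_pairedI) (auto intro!: continuous_map_from_subtopology)
      from openin_continuous_map_preimage[OF this V] show ?thesis
        unfolding T_def using X0 openin_trans_full by blast
    qed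
    have "\<exists>S. openin X S \<and> x \<in> S \<and> S \<subseteq> {x \<in> topspace X. join_map G u (Suc k) x \<in> W}"
      if x: "x \<in> topspace X" "join_map G u (Suc k) x \<in> W" for x
    proof -
      let ?g = "level_element G u (Suc k) x"
      let ?U = "{y \<in> topspace X. u (Suc k) ?g y \<in> {0<..}}"
      consider "t x = 0" | "0 < t x" "t x < 1" | "t x = 1"
        using t_bounds[of x] by linarith
      then show ?thesis
      proof cases
        case 1
        have "x \<in> X0" using 1 x by (simp add: X0_def)
        \<comment> \<open>At parameter 0 the right factor is undetermined nearby, so the
          neighbourhood must serve all of the finitely many \<open>g\<close> at once.\<close>
        have "openin X (\<Inter>g\<in>carrier G. T g)"
          using T finite_carrier carrier_nonempty by (intro openin_Inter) auto
        moreover have "x \<in> T g" if "g \<in> carrier G" for g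
        proof -
          have "q (join_map G u k x, Pt g, t x) = join_map G u (Suc k) x"
            unfolding F using 1 by (simp add: q_def join_combination_def)
          then show ?thesis
            using x \<open>x \<in> X0\<close> 1 that join_map_mem Pt by (simp add: T_def V_def D_def)
        qed
        moreover have "join_map G u (Suc k) y \<in> W" if "y \<in> (\<Inter>g\<in>carrier G. T g)" for y
          using that level_element_carrier[of "Suc k" y] unfolding F T_def V_def by blast
        moreover have "(\<Inter>g\<in>carrier G. T g) \<subseteq> topspace X"
          using carrier_nonempty by (auto simp: T_def)
        ultimately show ?thesis
          by (intro exI[of _ "\<Inter>g\<in>carrier G. T g"]) blast
      next
        case 2
        \<comment> \<open>On \<open>?U\<close> the right element is constantly
          \<open>?g\<close>.\<close>
        have "openin X (T ?g \<inter> ?U)"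
          using T upos level_element_carrier by blast
        moreover have "x \<in> T ?g \<inter> ?U"
          using 2 x t_pos join_map_mem Pt level_element_carrier
          unfolding F by (auto simp: T_def V_def D_def X0_def)
        moreover have "join_map G u (Suc k) y \<in> W" if "y \<in> T ?g \<inter> ?U" for y
          using that level_eq[OF level_element_carrier, of "Suc k" x y]
          unfolding F by (auto simp: T_def V_def)
        ultimately show ?thesis
          by (intro exI[of _ "T ?g \<inter> ?U"]) auto
      next
        case 3
        \<comment> \<open>Here the first join factor is undetermined, so a neighbourhood of the parameter 1
          valid for all of its points is needed; compactness of that factor provides it.\<close>
        let ?C = "prod_topology (E_space G k) (top_of_set {0..1::real})"
        define B where "B = {z \<in> topspace ?C. (fst z, Pt ?g, snd z) \<in> V}"
        \<comment> \<open>The parameters whose whole slice over \<open>E_space G k\<close> is sent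
          into \<open>W\<close>, written as the complement of the projection of a closed
          set.\<close>
        define S where "S = {0..1} - snd ` (topspace ?C - B)"
        have "continuous_map ?C D (\<lambda>z. (fst z, Pt ?g, snd z))"
          unfolding D_def using Pt[OF level_element_carrier]
          by (intro continuous_map_pairedI continuous_map_fst continuous_map_snd) auto
        then have "openin ?C B"
          unfolding B_def by (rule openin_continuous_map_preimage[OF _ V])
        then have "closedin (top_of_set {0..1}) (snd ` (topspace ?C - B))"
          using closed_map_snd[OF compact_E_space[OF finite_carrier, of k]]
          unfolding closed_map_def by blast
        then have S: "openin (top_of_set {0..1}) S"
          unfolding S_def by (simp add: closedin_def)
        have S_iff: "s \<in> S \<longleftrightarrow> s \<in> {0..1} \<and>
            (\<forall>a\<in>topspace (E_space G k). q (a, Pt ?g, s) \<in> W)" for s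
          unfolding S_def B_def V_def D_def using Pt[OF level_element_carrier, of "Suc k" x]
          by force
        let ?T = "?U \<inter> {y \<in> topspace X. t y \<in> S}"
        have "openin X ?T"
          using upos[OF level_element_carrier] openin_continuous_map_preimage[OF t_cont S] by blast
        moreover have "x \<in> ?T"
        proof -
          have "q (a, Pt ?g, t x) = join_map G u (Suc k) x" for a
            unfolding F using 3 by (simp add: q_def join_combination_def)
          then show ?thesis
            using x 3 t_pos by (simp add: S_iff)
        qed
        moreover have "join_map G u (Suc k) y \<in> W" if y: "y \<in> ?T" for y
        proof -
          have g: "level_element G u (Suc k) y = ?g"
            using y level_eq[OF level_element_carrier] by auto
          show ?thesis
          proof (cases "t y < 1")
            case True
            then have "y \<in> X0" using y by (simp add: X0_def)
            then show ?thesis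
              using y join_map_mem unfolding F g by (simp add: S_iff)
          next
            case False
            then have "t y = 1" using t_bounds[of y] by simp
            then have "join_map G u (Suc k) y = q (a0, Pt ?g, t y)"
              unfolding F g by (simp add: q_def join_combination_def)
            then show ?thesis
              using y a0 by (simp add: S_iff)
          qed
        qed
        ultimately show ?thesis
          by (intro exI[of _ ?T]) auto
      qed
    qed
    then show ?thesis
      by (subst openin_subopen) blast
  qed
  then show ?case
    unfolding E_Suc continuous_map_def topspace_quotient_topology using F_mem by blast
qed

end

section \<open>Equivariance of the map into the join\<close>

locale group_join_coordinates = join_coordinates G u + group G
  for G :: "('g, 'm) monoid_scheme" (structure) and u :: "nat \<Rightarrow> 'g \<Rightarrow> 'x \<Rightarrow> real"
begin

text \<open>Shifting by \<open>h\<close> permutes the summands of each level weight, so all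
  parameters agree, while the selected elements are multiplied by \<open>h\<close>. The shift is
  required for one pair \<open>x\<close>, \<open>y\<close>, so it can be supplied for points of the
  realization alone.\<close>

lemma join_map_equivariant:
  assumes "h \<in> carrier G"
    and shift: "\<And>j g. g \<in> carrier G \<Longrightarrow> u j (h \<otimes> g) y = u j g x"
    and "\<exists>j\<le>k. \<exists>g\<in>carrier G. 0 < u j g x"
  shows "join_map G u k y = join_action G h (join_map G u k x)"
  using assms(3)
proof (induction k)
  have element: "level_element G u j y = h \<otimes> level_element G u j x"
    if "\<exists>g\<in>carrier G. 0 < u j g x" for j
    using that assms(1) level_element_carrier[of j x]
    by (intro level_element_eq) (simp_all add: shift level_element_pos level_weight_pos_iff)
  {
    case 0
    then show ?case
      using element[of 0] by (simp add: join_action_Pt)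
  next
    case (Suc k)
    have "(\<Sum>g\<in>carrier G. u j g x) = (\<Sum>g\<in>carrier G. u j g y)" for j
      using assms(1)
      by (intro sum.reindex_bij_witness[of _ "\<lambda>g. inv h \<otimes> g" "\<lambda>g. h \<otimes> g"])
        (auto simp: shift m_assoc[symmetric])
    then have "level_weight G u j y = level_weight G u j x" for j
      by (simp add: level_weight_def)
    then have t: "join_parameter G u (Suc k) y = join_parameter G u (Suc k) x"
      by (simp add: join_parameter_def)
    have left: "join_map G u k y = join_action G h (join_map G u k x)"
      if "join_parameter G u (Suc k) x \<noteq> 1"
      using that Suc join_parameter_less_1_iff[OF Suc.prems] join_parameter_bounds(2)[of "Suc k" x]
      by auto
    have right: "level_element G u (Suc k) y = h \<otimes> level_element G u (Suc k) x"
      if "join_parameter G u (Suc k) x \<noteq> 0"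
      using that element join_parameter_pos_iff[OF Suc.prems] join_parameter_bounds(1)[of "Suc k" x]
      by auto
    show ?case
      using left right
      by (auto simp: t join_action_def join_combination_def)
  }
qed

end


section \<open>Geometric realizations\<close>

lemma topspace_geometric_realization: "topspace (geometric_realization K) = realization_points K"
proof -
  have "realization_points K \<inter> closed_simplex K \<sigma> = closed_simplex K \<sigma>" for \<sigma>
    by (auto simp: closed_simplex_def)
  then have "openin (geometric_realization K) (realization_points K)"
    by (simp add: openin_geometric_realization)
  then show ?thesis
    unfolding topspace_def[of "geometric_realization K"]
    by (auto simp: openin_geometric_realization)
qed

text \<open>Closed simplices carry the subspace topology of the product topology on functions, so
  the weak topology is at least as fine as the one induced by the coordinates.\<close>

lemma continuous_map_geometric_realization:
  fixes f :: "('v \<Rightarrow> real) \<Rightarrow> 'b::topological_space"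
  assumes "continuous_on UNIV f"
  shows "continuous_map (geometric_realization K) euclidean f"
proof -
  have "openin (top_of_set (closed_simplex K \<sigma>))
      ({x \<in> realization_points K. f x \<in> U} \<inter> closed_simplex K \<sigma>)" if "open U" for U \<sigma>
  proof -
    have "{x \<in> realization_points K. f x \<in> U} \<inter> closed_simplex K \<sigma> =
        closed_simplex K \<sigma> \<inter> f -` U"
      by (auto simp: closed_simplex_def)
    then show ?thesis
      using assms that by (simp add: open_vimage openin_open_Int)
  qed
  then show ?thesis
    by (auto simp: continuous_map_def topspace_geometric_realization openin_geometric_realization)
qed

lemma realization_map_apply:
  assumes "inj_on f S" "{v. x v \<noteq> 0} \<subseteq> S" "v \<in> S"
  shows "realization_map f x (f v) = x v"
proof -
  have "{w. x w \<noteq> 0 \<and> f w = f v} = (if x v \<noteq> 0 then {v} else {})"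
    using assms by (auto dest: inj_onD)
  then show ?thesis
    by (simp add: realization_map_def)
qed

section \<open>Patterns\<close>

text \<open>Positive exactly if \<open>A\<close> is a strict superlevel set of \<open>w\<close> on \<open>I\<close>; superlevel sets form
  a chain.\<close>

definition separation :: "'i set \<Rightarrow> 'i set \<Rightarrow> ('i \<Rightarrow> real) \<Rightarrow> real"
  where "separation I A w = (\<Prod>a\<in>A. \<Prod>b\<in>I - A. max 0 (w a - w b))"

lemma separation_nonneg: "0 \<le> separation I A w"
  unfolding separation_def by (intro prod_nonneg ballI) auto

lemma separation_pos_iff:
  assumes "finite I" "A \<subseteq> I"
  shows "0 < separation I A w \<longleftrightarrow> (\<forall>a\<in>A. \<forall>b\<in>I - A. w b < w a)"
proof -
  have "finite A" using assms finite_subset by blast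
  then have "separation I A w = 0 \<longleftrightarrow> (\<exists>a\<in>A. \<exists>b\<in>I - A. max 0 (w a - w b) = 0)"
    using assms by (simp add: separation_def)
  moreover have "max 0 (w a - w b) = 0 \<longleftrightarrow> \<not> w b < w a" for a b
    by auto
  ultimately show ?thesis
    using separation_nonneg[of I A w] by (auto simp: less_le)
qed

lemma separation_chain:
  assumes "finite I" "A \<subseteq> I" "B \<subseteq> I" "0 < separation I A w" "0 < separation I B w"
  shows "A \<subseteq> B \<or> B \<subseteq> A"
proof (rule ccontr)
  assume "\<not> ?thesis"
  then obtain a b where "a \<in> A - B" "b \<in> B - A" by blast
  then have "w b < w a" "w a < w b"
    using assms by (auto simp: separation_pos_iff)
  then show False by simp
qed

lemma separation_image:
  assumes "bij_betw f I I" "A \<subseteq> I" "\<And>a. a \<in> I \<Longrightarrow> w' (f a) = w a"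
  shows "separation I (f ` A) w' = separation I A w"
proof -
  have inj: "inj_on f A" "inj_on f (I - A)"
    using assms by (auto simp: bij_betw_def intro: inj_on_subset)
  have "I - f ` A = f ` (I - A)"
    using assms inj_on_image_set_diff[of f I I A] by (simp add: bij_betw_def)
  then have "separation I (f ` A) w' = (\<Prod>a\<in>A. \<Prod>b\<in>I - A. max 0 (w' (f a) - w' (f b)))"
    using inj by (simp add: separation_def prod.reindex)
  also have "\<dots> = separation I A w"
    unfolding separation_def using assms by (intro prod.cong refl) auto
  finally show ?thesis .
qed

section \<open>Covering patterns and their translates\<close>

definition fiber :: "nat \<Rightarrow> ('g \<times> nat) set \<Rightarrow> 'g set"
  where "fiber i A = {g. (g, i) \<in> A}"

text \<open>The bound on fibers serves twice: it limits the size of a pattern, and for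
  \<open>s < p\<close> with \<open>p\<close> prime it makes the size of a nonempty fiber invertible
  modulo \<open>p\<close>.\<close>

definition covering_patterns ::
  "('g, 'm) monoid_scheme \<Rightarrow> nat \<Rightarrow> nat \<Rightarrow> ('g \<times> nat) set set"
  where "covering_patterns G m s = {A. A \<subseteq> carrier G \<times> {1..m} \<and> fst ` A = carrier G \<and>
    (\<forall>i. card (fiber i A) \<le> s)}"

definition translate ::
  "('g, 'm) monoid_scheme \<Rightarrow> 'g \<Rightarrow> ('g \<times> nat) set \<Rightarrow> ('g \<times> nat) set"
  where "translate G h A = map_prod (\<lambda>g. h \<otimes>\<^bsub>G\<^esub> g) id ` A"

lemma fiber_translate: "fiber i (translate G h A) = (\<lambda>g. h \<otimes>\<^bsub>G\<^esub> g) ` fiber i A"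
  by (force simp: fiber_def translate_def)

context group
begin

lemma inj_on_mult_left: "h \<in> carrier G \<Longrightarrow> inj_on (\<lambda>g. h \<otimes> g) (carrier G)"
  by (auto intro: inj_onI)

lemma bij_betw_translation:
  assumes "h \<in> carrier G"
  shows "bij_betw (map_prod (\<lambda>g. h \<otimes> g) id) (carrier G \<times> J) (carrier G \<times> J)"
proof (rule bij_betw_byWitness[where f' = "map_prod (\<lambda>g. inv h \<otimes> g) id"])
qed (use assms in \<open>auto simp: m_assoc[symmetric]\<close>)

lemma translate_inverse:
  assumes "h \<in> carrier G" "A \<subseteq> carrier G \<times> J"
  shows "translate G (inv h) (translate G h A) = A"
proof -
  have "(map_prod (\<lambda>g. inv h \<otimes> g) id \<circ> map_prod (\<lambda>g. h \<otimes> g) id) a = a" if "a \<in> A" for a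
    using assms that by (auto simp: m_assoc[symmetric])
  then show ?thesis
    unfolding translate_def image_comp by force
qed

lemma card_translate:
  assumes "h \<in> carrier G" "A \<subseteq> carrier G \<times> J"
  shows "card (translate G h A) = card A"
  unfolding translate_def
  using bij_betw_translation[OF assms(1), of J] assms(2)
  by (intro card_image) (auto simp: bij_betw_def intro: inj_on_subset)

lemma translate_covering_patterns:
  assumes "h \<in> carrier G" "A \<in> covering_patterns G m s"
  shows "translate G h A \<in> covering_patterns G m s"
proof -
  have A: "A \<subseteq> carrier G \<times> {1..m}" "fst ` A = carrier G" "card (fiber i A) \<le> s" for i
    using assms(2) by (auto simp: covering_patterns_def)
  have "fiber i A \<subseteq> carrier G" for i
    using A(1) by (auto simp: fiber_def)
  then have "card (fiber i (translate G h A)) \<le> s" for i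
    using A(3)[of i] inj_on_mult_left[OF assms(1)]
    by (simp add: fiber_translate card_image inj_on_subset)
  moreover have "translate G h A \<subseteq> carrier G \<times> {1..m}"
    using A(1) assms(1) by (auto simp: translate_def)
  moreover have "fst ` translate G h A = (\<lambda>g. h \<otimes> g) ` fst ` A"
    by (force simp: translate_def)
  then have "fst ` translate G h A = carrier G"
    using A(2) assms(1) surj_const_mult by simp
  ultimately show ?thesis
    by (simp add: covering_patterns_def)
qed

end

text \<open>Projection to the group gives the lower bound, counting by color the upper one. Their
  difference bounds the levels of the join.\<close>

lemma card_covering_pattern:
  assumes "finite (carrier G)" "A \<in> covering_patterns G m s"
  shows "order G \<le> card A" "card A \<le> m * s"
proof -
  have A: "A \<subseteq> carrier G \<times> {1..m}" "fst ` A = carrier G" "card (fiber i A) \<le> s" for i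
    using assms(2) by (auto simp: covering_patterns_def)
  have "finite A"
    using A(1) assms(1) finite_subset by blast
  then show "order G \<le> card A"
    using A(2) card_image_le[of A fst] by (simp add: order_def)
  have "A = (\<Union>i\<in>{1..m}. fiber i A \<times> {i})"
    using A(1) by (auto simp: fiber_def)
  then have "card A \<le> (\<Sum>i\<in>{1..m}. card (fiber i A \<times> {i}))"
    by (metis card_UN_le finite_atLeastAtMost)
  also have "\<dots> \<le> (\<Sum>i\<in>{1..m}. s)"
    using A(3) by (intro sum_mono) (simp add: card_cartesian_product)
  finally show "card A \<le> m * s"
    by simp
qed

section \<open>The index bound for a proper coloring\<close>

text \<open>The group is any finite one; primality enters later, through the construction of the
  equivariant labelling \<open>lab\<close>.\<close>

locale colored_free_poset =
  fixes G :: "('g, 'm) monoid_scheme" (structure)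
    and P :: "'a set" and R :: "'a rel" and \<phi> :: "'g \<Rightarrow> 'a \<Rightarrow> 'a"
    and r m :: nat and c :: "'a \<Rightarrow> nat" and lab :: "('g \<times> nat) set \<Rightarrow> 'g"
  assumes free: "free_G_poset G P R \<phi>"
    and finite_G: "finite (carrier G)"
    and finite_P: "finite P"
    and r_pos: "0 < r"
    and coloring: "proper_coloring P (compatibility_edges G P R \<phi> r) m c"
    and lab_carrier: "\<And>A. A \<in> covering_patterns G m (r - 1) \<Longrightarrow> lab A \<in> carrier G"
    and lab_translate: "\<And>h A. h \<in> carrier G \<Longrightarrow> A \<in> covering_patterns G m (r - 1) \<Longrightarrow>
      lab (translate G h A) = h \<otimes> lab A"

sublocale colored_free_poset \<subseteq> group_action G P \<phi>
  using free by (simp add: free_G_poset_def G_poset_def)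

sublocale colored_free_poset \<subseteq> group G
  using group_hom group_hom.axioms(1) by blast

context colored_free_poset
begin

lemma order_preserving: "g \<in> carrier G \<Longrightarrow> (a, b) \<in> R \<Longrightarrow> (\<phi> g a, \<phi> g b) \<in> R"
  using free by (simp add: free_G_poset_def G_poset_def)

lemma comparable_shift:
  assumes "g \<in> carrier G" "h \<in> carrier G" "x \<in> P" "y \<in> P"
    and "comparable R (\<phi> g x) (\<phi> h y)"
  shows "comparable R x (\<phi> (inv g \<otimes> h) y)"
proof -
  have "\<phi> (inv g) (\<phi> g x) = x"
    using assms(1,3) orbit_sym_aux by blast
  moreover have "\<phi> (inv g) (\<phi> h y) = \<phi> (inv g \<otimes> h) y"
    using assms by (simp add: composition_rule)
  ultimately show ?thesis
    using assms(1,5) order_preserving[of "inv g"] unfolding comparable_def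
    by (metis inv_closed)
qed

text \<open>If \<open>y\<close> is below \<open>k y\<close>, applying powers of \<open>k\<close>
  gives an ascending sequence that returns to \<open>y\<close> after \<open>order G\<close> steps;
  antisymmetry yields \<open>k y = y\<close>, and freeness concludes. The descending case is
  symmetric.\<close>

lemma comparable_translate_eq_one:
  assumes "k \<in> carrier G" "y \<in> P" "comparable R y (\<phi> k y)"
  shows "k = \<one>"
proof -
  have po: "refl_on P R" "trans R" "antisym R"
    using free by (auto simp: free_G_poset_def G_poset_def partial_order_on_def preorder_on_def)
  have step: "\<phi> (k [^] Suc n) y = \<phi> k (\<phi> (k [^] n) y)" for n :: nat
    using composition_rule[of y k "k [^] n"] assms(1,2) nat_pow_Suc2[of k n] by simp
  have one: "\<phi> \<one> y = y"
    using id_eq_one assms(2) by (metis restrict_apply')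
  \<comment> \<open>The exponent is \<open>order G\<close>, written as a successor so that
    \<open>step\<close> splits off one factor.\<close>
  have cycle: "\<phi> (k [^] Suc (order G - 1)) y = y"
    using assms(1) finite_G one pow_order_eq_1 by (simp add: order_gt_0_iff_finite)
  have "\<phi> k y = y"
    using assms(3) unfolding comparable_def
  proof
    assume le: "(y, \<phi> k y) \<in> R"
    have "(y, \<phi> (k [^] n) y) \<in> R" for n :: nat
    proof (induction n)
      case 0
      then show ?case using po(1) assms(2) one by (simp add: refl_onD)
    next
      case (Suc n)
      then show ?case
        using order_preserving[OF assms(1)] le po(2) by (metis step transD)
    qed
    then have "(\<phi> k y, y) \<in> R"
      using order_preserving[OF assms(1)] cycle by (metis step)
    then show ?thesis using le po(3) by (metis antisymD)
  next
    assume le: "(\<phi> k y, y) \<in> R"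
    have "(\<phi> (k [^] n) y, y) \<in> R" for n :: nat
    proof (induction n)
      case 0
      then show ?case using po(1) assms(2) one by (simp add: refl_onD)
    next
      case (Suc n)
      then show ?case
        using order_preserving[OF assms(1)] le po(2) by (metis step transD)
    qed
    then have "(y, \<phi> k y) \<in> R"
      using order_preserving[OF assms(1)] cycle by (metis step)
    then show ?thesis using le po(3) by (metis antisymD)
  qed
  then show ?thesis
    using free assms(1,2) unfolding free_G_poset_def by blast
qed

section \<open>Color masses and the pattern of a point\<close>

text \<open>Substituting \<open>v = g y\<close>, this is the mass of those \<open>v\<close> whose
  pullback by \<open>g\<close> has color \<open>i\<close>. For a point of the realization, every
  \<open>g\<close> thus distributes the whole mass among the colors.\<close>

definition color_mass :: "('a \<Rightarrow> real) \<Rightarrow> 'g \<times> nat \<Rightarrow> real"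
  where "color_mass x = (\<lambda>(g, i). \<Sum>y\<in>{y \<in> P. c y = i}. x (\<phi> g y))"

abbreviation cells :: "('g \<times> nat) set"
  where "cells \<equiv> carrier G \<times> {1..m}"

abbreviation patterns :: "('g \<times> nat) set set"
  where "patterns \<equiv> covering_patterns G m (r - 1)"

lemma finite_cells: "finite cells"
  using finite_G by simp

lemma patterns_subset: "A \<in> patterns \<Longrightarrow> A \<subseteq> cells"
  by (simp add: covering_patterns_def)

lemma finite_patterns: "finite patterns"
  using patterns_subset finite_cells by (meson PowI finite_Pow_iff finite_subset subsetI)

lemma color_mass_pos_iff:
  assumes "\<And>v. 0 \<le> x v"
  shows "0 < color_mass x (g, i) \<longleftrightarrow> (\<exists>y\<in>P. c y = i \<and> 0 < x (\<phi> g y))"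
proof -
  have "color_mass x (g, i) = 0 \<longleftrightarrow> (\<forall>y\<in>{y \<in> P. c y = i}. x (\<phi> g y) = 0)"
    unfolding color_mass_def using finite_P assms by (simp add: sum_nonneg_eq_0_iff)
  moreover have "0 \<le> color_mass x (g, i)"
    unfolding color_mass_def using assms by (simp add: sum_nonneg)
  ultimately show ?thesis
    using assms by (auto simp: less_le)
qed

text \<open>Elements of one chain that carry the same color on \<open>r\<close> different translates would, pulled
  back by these translates, form a monochromatic edge.\<close>

lemma support_pattern:
  assumes x: "x \<in> realization_points (order_complex P R)"
  shows "{a \<in> cells. 0 < color_mass x a} \<in> patterns"
proof -
  let ?A = "{a \<in> cells. 0 < color_mass x a}"
  have x0: "0 \<le> x v" for v
    using x by (simp add: realization_points_def)
  have supp: "{v. x v \<noteq> 0} \<subseteq> P" "{v. x v \<noteq> 0} \<noteq> {}"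
    using x by (auto simp: realization_points_def order_complex_def)
  have chain: "comparable R v v'" if "0 < x v" "0 < x v'" for v v'
    using x that by (auto simp: realization_points_def order_complex_def)
  have A_iff: "(g, i) \<in> ?A \<longleftrightarrow> g \<in> carrier G \<and> (\<exists>y\<in>P. c y = i \<and> 0 < x (\<phi> g y))" for g i
    using coloring by (auto simp: color_mass_pos_iff[OF x0] proper_coloring_def)
  have "g \<in> fst ` ?A" if g: "g \<in> carrier G" for g
  proof -
    obtain v where v: "v \<in> P" "x v \<noteq> 0" using supp by blast
    obtain y where "y \<in> P" "\<phi> g y = v"
      using surj_prop[OF g] v(1) by (metis imageE)
    then have "(g, c y) \<in> ?A"
      using v x0[of v] g unfolding A_iff by force
    then show ?thesis by force
  qed
  moreover have "card (fiber i ?A) \<le> r - 1" for i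
  proof (rule ccontr)
    assume "\<not> ?thesis"
    then have "r \<le> card (fiber i ?A)" using r_pos by linarith
    then obtain S where S: "S \<subseteq> fiber i ?A" "card S = r" "finite S"
      using obtain_subset_with_card_n by blast
    have "\<forall>g\<in>S. g \<in> carrier G \<and> (\<exists>y\<in>P. c y = i \<and> 0 < x (\<phi> g y))"
      using S(1) A_iff unfolding fiber_def by blast
    then obtain f where f: "\<And>g. g \<in> S \<Longrightarrow> g \<in> carrier G"
      "\<And>g. g \<in> S \<Longrightarrow> f g \<in> P \<and> c (f g) = i \<and> 0 < x (\<phi> g (f g))"
      by metis
    have compatible: "comparable R (f g) (\<phi> (inv g \<otimes> h) (f h))" if "g \<in> S" "h \<in> S" for g h
      using that f chain by (intro comparable_shift) auto
    have distinct: "inv g \<otimes> h \<noteq> \<one>" if "g \<in> S" "h \<in> S" "g \<noteq> h" for g h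
      using that f(1) by (metis inv_closed inv_equality inv_inv)
    \<comment> \<open>If two pullbacks coincided, that element would be comparable with its
      translate by a nontrivial group element. Hence the edge really has \<open>r\<close>
      vertices.\<close>
    have "inj_on f S"
    proof (rule inj_onI, rule ccontr)
      fix g h assume gh: "g \<in> S" "h \<in> S" "f g = f h" "g \<noteq> h"
      then show False
        using compatible[OF gh(1,2)] comparable_translate_eq_one[of "inv g \<otimes> h" "f h"]
          distinct[OF gh(1,2,4)] f by simp
    qed
    then have "card (f ` S) = r" using S(2) by (simp add: card_image)
    moreover have "\<exists>k\<in>carrier G - {\<one>}. comparable R y (\<phi> k z)"
      if "y \<in> f ` S" "z \<in> f ` S" "y \<noteq> z" for y z
    proof -
      obtain g h where "g \<in> S" "h \<in> S" "y = f g" "z = f h" "g \<noteq> h"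
        using \<open>y \<in> f ` S\<close> \<open>z \<in> f ` S\<close> \<open>y \<noteq> z\<close> by blast
      then show ?thesis
        using compatible distinct f(1) by (intro bexI[of _ "inv g \<otimes> h"]) auto
    qed
    ultimately have "f ` S \<in> compatibility_edges G P R \<phi> r"
      using f(2) S(3) by (auto simp: compatibility_edges_def)
    moreover have "\<forall>v\<in>f ` S. c v = i"
      using f(2) by simp
    ultimately have "\<exists>e\<in>compatibility_edges G P R \<phi> r. \<exists>i. \<forall>v\<in>e. c v = i"
      by blast
    then show False
      using coloring unfolding proper_coloring_def by simp
  qed
  ultimately show ?thesis
    by (auto simp: covering_patterns_def)
qed

section \<open>Weights of patterns as join coordinates\<close>

text \<open>A pattern contributes to the join factor indexed by the excess of its size over
  \<open>order G\<close>, at the vertex given by its label.\<close>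

definition pattern_weight :: "nat \<Rightarrow> 'g \<Rightarrow> ('a \<Rightarrow> real) \<Rightarrow> real"
  where "pattern_weight j g x =
    (\<Sum>A | A \<in> patterns \<and> card A = order G + j \<and> lab A = g. separation cells A (color_mass x))"

lemma pattern_weight_pos_iff:
  "0 < pattern_weight j g x \<longleftrightarrow>
    (\<exists>A\<in>patterns. card A = order G + j \<and> lab A = g \<and> 0 < separation cells A (color_mass x))"
proof -
  let ?Q = "{A. A \<in> patterns \<and> card A = order G + j \<and> lab A = g}"
  have "finite ?Q" using finite_patterns by simp
  then have "pattern_weight j g x = 0 \<longleftrightarrow> (\<forall>A\<in>?Q. separation cells A (color_mass x) = 0)"
    unfolding pattern_weight_def by (intro sum_nonneg_eq_0_iff) (auto simp: separation_nonneg)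
  moreover have "0 \<le> pattern_weight j g x"
    unfolding pattern_weight_def by (intro sum_nonneg separation_nonneg)
  ultimately show ?thesis
    using separation_nonneg[of cells _ "color_mass x"] by (auto simp: less_le)
qed

text \<open>Patterns of positive separation are nested, so two of equal size coincide and have the
  same label.\<close>

sublocale coords: group_join_coordinates G pattern_weight
proof unfold_locales
  show "finite (carrier G)" "carrier G \<noteq> {}"
    using finite_G by auto
  show "0 \<le> pattern_weight j g x" for j g x
    unfolding pattern_weight_def by (intro sum_nonneg separation_nonneg)
  fix j g h x
  assume "0 < pattern_weight j g x" "0 < pattern_weight j h x"
  then obtain A B where AB: "A \<in> patterns" "B \<in> patterns" "card A = card B" "lab A = g" "lab B = h"
      "0 < separation cells A (color_mass x)" "0 < separation cells B (color_mass x)"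
    unfolding pattern_weight_pos_iff by metis
  have sub: "A \<subseteq> cells" "B \<subseteq> cells"
    using patterns_subset AB(1,2) by blast+
  have "A \<subseteq> B \<or> B \<subseteq> A"
    using separation_chain[OF finite_cells sub AB(6,7)] .
  then have "A = B"
    using AB(3) sub finite_cells by (metis card_subset_eq finite_subset)
  then show "g = h" using AB(4,5) by simp
qed

lemma continuous_pattern_weight: "continuous_on UNIV (pattern_weight j g)"
  unfolding pattern_weight_def separation_def color_mass_def split_def
  by (intro continuous_intros continuous_on_max continuous_on_product_coordinates)

text \<open>Translation by \<open>h\<close> permutes the patterns, preserves size, multiplies labels
  by \<open>h\<close> and carries the color masses of \<open>x\<close> to those of its image, so the
  two sums match term by term.\<close>

lemma pattern_weight_equivariant:
  assumes h: "h \<in> carrier G" and supp: "{v. x v \<noteq> 0} \<subseteq> P" and g: "g \<in> carrier G"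
  shows "pattern_weight j (h \<otimes> g) (realization_map (\<phi> h) x) = pattern_weight j g x"
proof -
  let ?x = "realization_map (\<phi> h) x"
  have mass: "color_mass ?x (map_prod (\<lambda>g. h \<otimes> g) id a) = color_mass x a" if a: "a \<in> cells" for a
  proof -
    obtain k i where ki: "a = (k, i)" "k \<in> carrier G" using a by auto
    have "?x (\<phi> (h \<otimes> k) y) = x (\<phi> k y)" if "y \<in> P" for y
      using realization_map_apply[OF inj_prop[OF h] supp element_image[OF ki(2) that refl]]
        composition_rule[OF that h ki(2)] by simp
    then show ?thesis
      by (simp add: color_mass_def ki(1))
  qed
  have sep: "separation cells (translate G h A) (color_mass ?x) = separation cells A (color_mass x)"
    if "A \<in> patterns" for A
    unfolding translate_def
    by (intro separation_image bij_betw_translation mass patterns_subset h that)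
  have inv_lab: "lab (translate G (inv h) A) = g" if "A \<in> patterns" "lab A = h \<otimes> g" for A
    using that h g by (simp add: lab_translate m_assoc[symmetric])
  have inverse: "translate G (inv h) (translate G h A) = A"
    "translate G h (translate G (inv h) A) = A" if "A \<in> patterns" for A
    using that h translate_inverse[of h A] translate_inverse[of "inv h" A] patterns_subset[OF that]
    by auto
  have "pattern_weight j g x = pattern_weight j (h \<otimes> g) ?x"
    unfolding pattern_weight_def
  proof (rule sum.reindex_bij_witness[of _ "translate G (inv h)" "translate G h"])
    fix A assume "A \<in> {A. A \<in> patterns \<and> card A = order G + j \<and> lab A = g}"
    then show "translate G (inv h) (translate G h A) = A"
      "translate G h A \<in> {A. A \<in> patterns \<and> card A = order G + j \<and> lab A = h \<otimes> g}"
      "separation cells (translate G h A) (color_mass ?x) = separation cells A (color_mass x)"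
      using h inverse sep
      by (auto simp: translate_covering_patterns lab_translate card_translate[OF _ patterns_subset])
  next
    fix A assume "A \<in> {A. A \<in> patterns \<and> card A = order G + j \<and> lab A = h \<otimes> g}"
    then show "translate G h (translate G (inv h) A) = A"
      "translate G (inv h) A \<in> {A. A \<in> patterns \<and> card A = order G + j \<and> lab A = g}"
      using h inverse inv_lab
      by (auto simp: translate_covering_patterns card_translate[OF _ patterns_subset])
  qed
  then show ?thesis ..
qed

text \<open>The pattern of \<open>x\<close> itself is the witness: masses are positive on it and not
  positive elsewhere, so its separation is positive.\<close>

lemma pattern_weight_ex_pos:
  assumes x: "x \<in> realization_points (order_complex P R)"
  shows "\<exists>j\<le>m * (r - 1) - order G. \<exists>g\<in>carrier G. 0 < pattern_weight j g x"
proof -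
  let ?A = "{a \<in> cells. 0 < color_mass x a}"
  have A: "?A \<in> patterns" by (rule support_pattern[OF x])
  have "0 < separation cells ?A (color_mass x)"
    using finite_cells by (subst separation_pos_iff) auto
  then have "0 < pattern_weight (card ?A - order G) (lab ?A) x"
    unfolding pattern_weight_pos_iff
    using A card_covering_pattern(1)[OF finite_G A] by (intro bexI[of _ ?A]) auto
  then show ?thesis
    using card_covering_pattern(2)[OF finite_G A] lab_carrier[OF A] by (meson diff_le_mono)
qed

theorem G_index_le:
  "G_index G (geometric_realization (order_complex P R)) (\<lambda>g. realization_map (\<phi> g))
    \<le> m * (r - 1) - order G"
proof -
  let ?k = "m * (r - 1) - order G" and ?X = "geometric_realization (order_complex P R)"
  have "continuous_map ?X (E_space G ?k) (join_map G pattern_weight ?k)"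
    using continuous_pattern_weight pattern_weight_ex_pos
    by (intro coords.continuous_join_map continuous_map_geometric_realization)
      (auto simp: topspace_geometric_realization)
  moreover have "join_map G pattern_weight ?k (realization_map (\<phi> g) x) =
      join_action G g (join_map G pattern_weight ?k x)"
    if "g \<in> carrier G" "x \<in> topspace ?X" for g x
  proof -
    have "{v. x v \<noteq> 0} \<subseteq> P" "x \<in> realization_points (order_complex P R)"
      using that(2)
      by (auto simp: topspace_geometric_realization realization_points_def order_complex_def)
    then show ?thesis
      using that(1) pattern_weight_equivariant pattern_weight_ex_pos
      by (intro coords.join_map_equivariant) auto
  qed
  ultimately have "equivariant_map G ?X (\<lambda>g. realization_map (\<phi> g))
      (E_space G ?k) (join_action G) (join_map G pattern_weight ?k)"
    by (simp add: equivariant_map_def)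
  then show ?thesis
    unfolding G_index_def by (intro Least_le) blast
qed

text \<open>This makes the truncated subtraction in \<open>G_index_le\<close> exact. The pattern of
  a single vertex has a size between the two bounds.\<close>

lemma order_le:
  assumes "P \<noteq> {}"
  shows "order G \<le> m * (r - 1)"
proof -
  obtain v where v: "v \<in> P" using assms by blast
  have "(v, v) \<in> R"
    using free v
    by (auto simp: free_G_poset_def G_poset_def partial_order_on_def preorder_on_def refl_on_def)
  moreover have "{w. (if w = v then 1 else 0) \<noteq> (0::real)} = {v}"
    by auto
  ultimately have "(\<lambda>w. if w = v then 1 else 0) \<in> realization_points (order_complex P R)"
    using v by (simp add: realization_points_def order_complex_def comparable_def)
  from card_covering_pattern[OF finite_G support_pattern[OF this]] show ?thesis
    by linarith
qed

end

section \<open>Labelling patterns over the integers modulo a prime\<close>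

text \<open>A nonempty proper subset \<open>B\<close> of $\mathbb{Z}/p$ has a mean, since its cardinality is invertible
  modulo \<open>p\<close>, and translating \<open>B\<close> translates the mean.\<close>

definition mod_mean :: "nat \<Rightarrow> int set \<Rightarrow> int"
  where "mod_mean p B = ((SOME t. [t * int (card B) = 1] (mod int p)) * \<Sum>B) mod int p"

text \<open>Modulo \<open>p\<close>, translation adds \<open>h\<close> times the cardinality to the
  sum; the inverse of the cardinality, the same for both sets, turns this into
  \<open>h\<close>.\<close>

lemma mod_mean_translate:
  assumes "prime p" "B \<subseteq> {0..<int p}" "B \<noteq> {}" "card B < p"
  shows "mod_mean p ((\<lambda>g. (h + g) mod int p) ` B) = (h + mod_mean p B) mod int p"
proof -
  let ?f = "\<lambda>g. (h + g) mod int p"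
  have "inj_on ?f B"
  proof (rule inj_onI)
    fix a b assume ab: "a \<in> B" "b \<in> B" "(h + a) mod int p = (h + b) mod int p"
    then have "[a = b] (mod int p)"
      by (simp add: cong_def[symmetric] cong_add_lcancel)
    then show "a = b"
      using ab assms(2) by (metis atLeastLessThan_iff cong_less_imp_eq_int subsetD)
  qed
  then have card: "card (?f ` B) = card B" and sum: "\<Sum>(?f ` B) = (\<Sum>g\<in>B. ?f g)"
    by (simp_all add: card_image sum.reindex)
  have finite: "finite B" using assms(2) finite_subset by blast
  then have "0 < card B" using assms(3) by (simp add: card_gt_0_iff)
  then have "coprime (card B) p"
    using assms(1,4) by (metis coprime_commute nat_dvd_not_less prime_imp_coprime)
  then have "coprime (int (card B)) (int p)" by simp
  then have "\<exists>t. [t * int (card B) = 1] (mod int p)"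
    using cong_solve_coprime_int by (metis mult.commute)
  then have t: "[(SOME t. [t * int (card B) = 1] (mod int p)) * int (card B) = 1] (mod int p)"
    by (rule someI_ex)
  define t where "t = (SOME t. [t * int (card B) = 1] (mod int p))"
  have "[(\<Sum>g\<in>B. ?f g) = (\<Sum>g\<in>B. h + g)] (mod int p)"
    by (intro cong_sum) (simp add: cong_def)
  also have "(\<Sum>g\<in>B. h + g) = int (card B) * h + \<Sum>B"
    by (simp add: sum.distrib)
  finally have "[t * (\<Sum>g\<in>B. ?f g) = t * (int (card B) * h + \<Sum>B)] (mod int p)"
    by (rule cong_scalar_left)
  also have "t * (int (card B) * h + \<Sum>B) = t * int (card B) * h + t * \<Sum>B"
    by (simp add: algebra_simps)
  also have "[\<dots> = 1 * h + t * \<Sum>B] (mod int p)"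
    using t unfolding t_def[symmetric] by (intro cong_add cong_mult cong_refl)
  finally have "(t * (\<Sum>g\<in>B. ?f g)) mod int p = (h + t * \<Sum>B) mod int p"
    by (simp add: cong_def)
  then show ?thesis
    unfolding mod_mean_def card sum t_def[symmetric] by (simp add: mod_add_right_eq)
qed

definition pattern_mean :: "nat \<Rightarrow> (int \<times> nat) set \<Rightarrow> int"
  where "pattern_mean p A = mod_mean p (fiber (LEAST i. fiber i A \<noteq> {}) A)"

text \<open>Translation moves only the group coordinate, so the least occurring color is unchanged,
  and its fiber has fewer than \<open>p\<close> elements.\<close>

lemma pattern_mean_translate:
  assumes "prime p" "s < p" "A \<in> covering_patterns (integer_mod_group p) m s"
  shows "pattern_mean p (translate (integer_mod_group p) h A) =
    h \<otimes>\<^bsub>integer_mod_group p\<^esub> pattern_mean p A"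
proof -
  let ?Z = "integer_mod_group p"
  have "p \<noteq> 0" using assms(2) by simp
  have A: "A \<subseteq> carrier ?Z \<times> {1..m}" "fst ` A = carrier ?Z" "card (fiber i A) \<le> s" for i
    using assms(3) by (auto simp: covering_patterns_def)
  let ?i = "LEAST i. fiber i A \<noteq> {}"
  have "A \<noteq> {}"
    using A(2) integer_mod_group_0[of p] by (metis empty_iff image_empty)
  then have "\<exists>i. fiber i A \<noteq> {}"
    by (auto simp: fiber_def)
  then have "fiber ?i A \<noteq> {}" by (rule LeastI_ex)
  moreover have "fiber ?i A \<subseteq> {0..<int p}"
    using A(1) \<open>p \<noteq> 0\<close> by (auto simp: fiber_def carrier_integer_mod_group)
  ultimately show ?thesis
    using assms(1,2) A(3)[of ?i]
    by (simp add: pattern_mean_def fiber_translate mod_mean_translate)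
qed

section \<open>Existence of colorings and arithmetic of the bound\<close>

text \<open>An injective coloring suffices. Existence ensures that the \<open>LEAST\<close> in
  \<open>chromatic_number\<close> is attained.\<close>

lemma ex_proper_coloring:
  assumes "finite V" "\<And>e. e \<in> E \<Longrightarrow> e \<subseteq> V \<and> 2 \<le> card e"
  shows "\<exists>m c. proper_coloring V E m c"
proof -
  obtain c where c: "bij_betw c V {1..card V}"
    using assms(1) by (metis bij_betw_iff_card card_atLeastAtMost diff_Suc_1 finite_atLeastAtMost)
  have False if "e \<in> E" "\<forall>v\<in>e. c v = i" for e i
  proof -
    have "inj_on c e"
      using c assms(2)[OF that(1)] by (auto simp: bij_betw_def intro: inj_on_subset)
    then have "card e = card (c ` e)" by (simp add: card_image)
    also have "\<dots> \<le> card {i}" using that(2) by (intro card_mono) auto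
    finally show False using assms(2)[OF that(1)] by simp
  qed
  then have "proper_coloring V E (card V) c"
    using c unfolding proper_coloring_def bij_betw_def by blast
  then show ?thesis by blast
qed

text \<open>With \<open>q\<close> the second ceiling, \<open>(q - 1) * s < p\<close>. Over the
  integers this strictness gains 1, so
  \<open>n + 1 + (q - 1) * s \<le> n + p \<le> m * s\<close>.\<close>

lemma ceiling_sum_bound:
  fixes n p m s :: nat
  assumes "0 < s" "n + p \<le> m * s"
  shows "\<lceil>(real n + 1) / real s\<rceil> + \<lceil>real p / real s\<rceil> - 1 \<le> int m"
proof -
  define q where "q = \<lceil>real p / real s\<rceil>"
  have "real_of_int (q - 1) < real p / real s"
    unfolding q_def by linarith
  then have "real_of_int ((q - 1) * int s) < real_of_int (int p)"
    using assms(1) by (simp add: field_simps)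
  then have "(q - 1) * int s < int p"
    by linarith
  moreover have "int n + int p \<le> int m * int s"
    using assms(2) by (metis of_nat_add of_nat_le_iff of_nat_mult)
  ultimately have "int n + 1 \<le> (int m - q + 1) * int s"
    by (simp add: algebra_simps)
  then have "real_of_int (int n + 1) \<le> real_of_int ((int m - q + 1) * int s)"
    by (simp only: of_int_le_iff)
  then have "(real n + 1) / real s \<le> real_of_int (int m - q + 1)"
    using assms(1) by (simp add: divide_le_eq)
  then have "\<lceil>(real n + 1) / real s\<rceil> \<le> int m - q + 1"
    by (simp only: ceiling_le_iff)
  then show ?thesis
    unfolding q_def by linarith
qed

theorem theorem5p3:
  fixes p r :: nat
    and P :: "'a set"
    and R :: "'a rel"
    and \<phi> :: "int \<Rightarrow> 'a \<Rightarrow> 'a"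
  assumes "prime p"
    and "finite P"
    and "P \<noteq> {}"
    and "free_G_poset (integer_mod_group p) P R \<phi>"
    and "2 \<le> r" and "r \<le> p"
  shows "\<lceil>(real (G_index (integer_mod_group p)
              (geometric_realization (order_complex P R))
              (\<lambda>g. realization_map (\<phi> g))) + 1) / (real r - 1)\<rceil>
           + \<lceil>real p / (real r - 1)\<rceil> - 1
         \<le> int (chromatic_number P (compatibility_edges (integer_mod_group p) P R \<phi> r))"
proof -
  let ?Z = "integer_mod_group p"
  define m where "m = chromatic_number P (compatibility_edges ?Z P R \<phi> r)"
  have "\<exists>m c. proper_coloring P (compatibility_edges ?Z P R \<phi> r) m c"
    using assms(2,5) by (intro ex_proper_coloring) (auto simp: compatibility_edges_def)
  then obtain c where c: "proper_coloring P (compatibility_edges ?Z P R \<phi> r) m c"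
    unfolding m_def chromatic_number_def by (rule LeastI_ex[THEN exE])
  have p: "0 < p" using assms by simp
  have carrier: "carrier ?Z = {0..<int p}"
    using p by (simp add: carrier_integer_mod_group)
  interpret colored_free_poset ?Z P R \<phi> r m c "pattern_mean p"
  proof
    show "pattern_mean p A \<in> carrier ?Z" for A
      using p by (simp add: carrier pattern_mean_def mod_mean_def)
    show "pattern_mean p (translate ?Z h A) = h \<otimes>\<^bsub>?Z\<^esub> pattern_mean p A"
      if "A \<in> covering_patterns ?Z m (r - 1)" for h A
      \<comment> \<open>Here \<open>r \<le> p\<close> gives \<open>r - 1 < p\<close>, so no fiber is
        the whole group.\<close>
      using that assms by (intro pattern_mean_translate) auto
  qed (use assms c carrier in auto)
  have order: "order ?Z = p"
    by (simp add: order_def carrier)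
  have "G_index ?Z (geometric_realization (order_complex P R)) (\<lambda>g. realization_map (\<phi> g)) + p
      \<le> m * (r - 1)"
    using G_index_le order_le[OF assms(3)] unfolding order by linarith
  then show ?thesis
    using ceiling_sum_bound[of "r - 1" _ p m] assms(5) unfolding m_def by (simp add: of_nat_diff)
qed

end
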